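(* Let $v>0$, $\lambda>0$, and let $\{X(t), t>0\}$ be the telegraph process with velocity $v$ and rate $\lambda$. Then for every integer $p\geq 1$ and every $t>0$, $$ \mathbf{E}\, X(t)^p = \left(1+(-1)^p\right)(vt)^p\left(\frac{2}{\lambda t}\right)^{\frac{p-1}{2}}\Gamma\left(\frac{p+1}{2}\right)\left\{I_{\frac{p+1}{2}}(\lambda t)+I_{\frac{p-1}{2}}(\lambda t)\right\}\frac{e^{-\lambda t}}{2}. $$
   Context: The telegraph process with velocity $v>0$ and rate $\lambda>0$ is defined by $$X(t)=V(0)\int_0^t(-1)^{N(s)}\,\mathrm{d}s,\qquad t>0,$$ where $\{N(t),t\ge 0\}$ is a homogeneous Poisson process with rate $\lambda$, $N(0)=0$, and $V(0)$ is a random variable independent of $N$ taking the values $+v$ and $-v$ with probability $1/2$ each. $\Gamma(x)=\int_0^\infty e^{-s}s^{x-1}\,\mathrm{d}s$ is the Gamma function, and $I_\nu$ is the modified Bessel function of the first kind, $$I_\nu(x)=\sum_{k=0}^\infty\frac{1}{\Gamma(k+1+\nu)\,k!}\left(\frac{x}{2}\right)^{2k+\nu}.$$ *)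

theory Defs
  imports "HOL-Probability.Probability"
begin

text \<open>
  The process is indexed by \<^typ>\<open>real\<close>, but only times \<open>t \<ge> 0\<close> are constrained. The paths of the
  counting process are required to be right-continuous and nondecreasing for every outcome, so the
  truncated subtraction in the increments is the genuine one.
\<close>

locale poisson_process = prob_space M
  for M :: "'a measure" and rate :: real and N :: "real \<Rightarrow> 'a \<Rightarrow> nat" +
  assumes rate_pos: "0 < rate"
    and N_measurable: "\<And>t. 0 \<le> t \<Longrightarrow> random_variable (count_space UNIV) (N t)"
    and N_zero: "\<And>\<omega>. \<omega> \<in> space M \<Longrightarrow> N 0 \<omega> = 0"
    and N_mono: "\<And>\<omega>. \<omega> \<in> space M \<Longrightarrow> mono_on {0..} (\<lambda>t. N t \<omega>)"
    and N_right_continuous: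
      "\<And>\<omega> t. \<omega> \<in> space M \<Longrightarrow> 0 \<le> t \<Longrightarrow> continuous (at_right t) (\<lambda>s. N s \<omega>)"
    and N_increments:
      "\<And>s t. 0 \<le> s \<Longrightarrow> s < t \<Longrightarrow>
        distr M (count_space UNIV) (\<lambda>\<omega>. N t \<omega> - N s \<omega>) = measure_pmf (poisson_pmf (rate * (t - s)))"
    and N_indep_increments:
      "\<And>(n :: nat) (\<tau> :: nat \<Rightarrow> real). 0 \<le> \<tau> 0 \<Longrightarrow> (\<And>i. i < n \<Longrightarrow> \<tau> i < \<tau> (Suc i)) \<Longrightarrow>
        indep_vars (\<lambda>_. count_space UNIV) (\<lambda>i \<omega>. N (\<tau> (Suc i)) \<omega> - N (\<tau> i) \<omega>) {..<n}"

text \<open>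
  \<open>V\<close> is the initial velocity \<open>V(0)\<close>. It is independent of the whole process \<open>N\<close>, regarded as a
  single random element of the product space \<open>\<nat>\<^bsup>[0,\<infinity>)\<^esup>\<close>. Independence is stated for the generated
  \<open>\<sigma>\<close>-algebras because \<open>indep_var\<close> needs both random variables to have the same type.
\<close>

locale telegraph_process = poisson_process M rate N
  for M :: "'a measure" and v :: real and rate :: real
    and V :: "'a \<Rightarrow> real" and N :: "real \<Rightarrow> 'a \<Rightarrow> nat" +
  assumes v_pos: "0 < v"
    and V_measurable: "random_variable borel V"
    and V_plus: "prob {\<omega> \<in> space M. V \<omega> = v} = 1 / 2"
    and V_minus: "prob {\<omega> \<in> space M. V \<omega> = - v} = 1 / 2"
    and V_indep_N:
      "indep_set (sets (vimage_algebra (space M) V borel))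
        (sets (vimage_algebra (space M) (\<lambda>\<omega>. restrict (\<lambda>t. N t \<omega>) {0..})
          (PiM {0..} (\<lambda>_. count_space UNIV))))"

definition telegraph :: "('a \<Rightarrow> real) \<Rightarrow> (real \<Rightarrow> 'a \<Rightarrow> nat) \<Rightarrow> real \<Rightarrow> 'a \<Rightarrow> real" where
  "telegraph V N t \<omega> = V \<omega> * (LINT s:{0..t}|lborel. (- 1) ^ N s \<omega>)"

text \<open>
  Meant for \<open>x > 0\<close>: since \<open>0 powr 0 = 0\<close>, the value at \<open>x = 0\<close>, \<open>\<nu> = 0\<close> is not the usual one.
\<close>

definition bessel_I :: "real \<Rightarrow> real \<Rightarrow> real" where
  "bessel_I \<nu> x =
    (\<Sum>k. 1 / (Gamma (real k + 1 + \<nu>) * fact k) * (x / 2) powr (2 * real k + \<nu>))"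

end

theory Submission
  imports Defs
begin

text \<open>
  Write \<open>Y(t)\<close> for the integral of \<open>(-1)\<^sup>N\<close> over \<open>[0,t]\<close>, so that \<open>X(t) = V(0) Y(t)\<close> with independent factors,
  and put \<open>u\<^sub>k(t) = E Y(t)\<^sup>k\<close> and \<open>w\<^sub>k(t) = E (Y(t)\<^sup>k (-1)\<^bsup>N(t)\<^esup>)\<close>. Integrating the derivative of
  \<open>Y\<^sup>k\<^sup>+\<^sup>1\<close> along each path and using that \<open>N(t) - N(s)\<close> is independent of the path up to time \<open>s\<close> gives
  \<open>u\<^sub>k\<^sub>+\<^sub>1(t) = (k+1) \<integral> w\<^sub>k(s) ds\<close> and \<open>w\<^sub>k\<^sub>+\<^sub>1(t) = (k+1) \<integral> exp(-2\<lambda>(t-s)) u\<^sub>k(s) ds\<close>, both over \<open>[0,t]\<close>.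
  Starting from \<open>u\<^sub>0 = 1\<close>, the Bessel expressions for \<open>u\<^sub>2\<^sub>m\<close> and \<open>w\<^sub>2\<^sub>m\<^sub>+\<^sub>1\<close> satisfy the same recursion, by
  the differentiation and three-term recurrence formulas of the Bessel series. Odd moments of \<open>X\<close>
  vanish because those of \<open>V(0)\<close> do.
\<close>

subsection \<open>Bessel series\<close>

text \<open>This is \<open>0F1(; \<mu>; x) / Gamma \<mu>\<close>, the entire factor left of
  \<open>I_(\<mu>-1)\<close> once the fractional power is split off. It is a genuine power series,
  hence differentiable also at 0, where \<open>powr\<close> is awkward.\<close>

definition bessel_series :: "real \<Rightarrow> real \<Rightarrow> real" where
  "bessel_series \<mu> x = (\<Sum>k. 1 / (Gamma (real k + \<mu>) * fact k) * x ^ k)"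

text \<open>Ratio test: by \<open>Gamma (z + 1) = z * Gamma z\<close>, consecutive terms have ratio
  \<open>\<bar>x\<bar> / ((k + \<mu>) * (k + 1))\<close> in absolute value, which tends to
  0.\<close>

lemma summable_bessel_series:
  fixes \<mu> x :: real
  assumes "0 < \<mu>"
  shows "summable (\<lambda>k. 1 / (Gamma (real k + \<mu>) * fact k) * x ^ k)"
proof -
  \<comment> \<open>Chosen so that \<open>\<mu> * n\<close> exceeds
    \<open>2 * \<bar>x\<bar>\<close>; for \<open>k\<close> from \<open>n\<close> on, the denominator
    of the ratio is at least \<open>\<mu> * n\<close>.\<close>
  obtain n where n: "2 * \<bar>x\<bar> / \<mu> < real n"
    using reals_Archimedean2 by blast
  show ?thesis
  proof (rule summable_ratio_test[where c = "1/2" and N = n])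
    fix k assume k: "n \<le> k"
    have G: "Gamma (real (Suc k) + \<mu>) = (real k + \<mu>) * Gamma (real k + \<mu>)"
      using Gamma_plus1[of "real k + \<mu>"] assms
      by (auto simp: algebra_simps nonpos_Ints_def)
    have pos': "0 < (real k + \<mu>) * real (Suc k)"
      using assms by simp
    have "2 * \<bar>x\<bar> \<le> \<mu> * real n"
      using n assms by (simp add: field_simps)
    also have "\<dots> \<le> (real k + \<mu>) * real (Suc k)"
      using k assms by (intro mult_mono) auto
    finally have le: "\<bar>x\<bar> / ((real k + \<mu>) * real (Suc k)) \<le> 1/2"
      using pos' by (simp add: pos_divide_le_eq)
    have pos: "Gamma (real k + \<mu>) > 0" using assms by (intro Gamma_real_pos) auto
    have "norm (1 / (Gamma (real (Suc k) + \<mu>) * fact (Suc k)) * x ^ Suc k)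
        = \<bar>x\<bar> / ((real k + \<mu>) * real (Suc k)) * norm (1 / (Gamma (real k + \<mu>) * fact k) * x ^ k)"
      unfolding G using pos assms by (simp add: abs_mult power_abs divide_simps) 
    also have "\<dots> \<le> 1/2 * norm (1 / (Gamma (real k + \<mu>) * fact k) * x ^ k)"
      by (intro mult_right_mono le) auto
    finally show "norm (1 / (Gamma (real (Suc k) + \<mu>) * fact (Suc k)) * x ^ Suc k)
        \<le> 1/2 * norm (1 / (Gamma (real k + \<mu>) * fact k) * x ^ k)" .
  qed simp
qed

lemma bessel_series_0: "bessel_series \<mu> 0 = 1 / Gamma \<mu>"
  using powser_sums_zero[of "\<lambda>k. 1 / (Gamma (real k + \<mu>) * fact k)"]
  unfolding bessel_series_def by (simp add: sums_iff)

text \<open>Termwise differentiation: the factor \<open>k + 1\<close> cancels against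
  \<open>fact (k + 1)\<close>, and the index shift moves into the Gamma argument as
  \<open>\<mu> + 1\<close>.\<close>

lemma DERIV_bessel_series:
  assumes "0 < \<mu>"
  shows "(bessel_series \<mu> has_real_derivative bessel_series (\<mu> + 1) x) (at x)"
proof -
  define c where "c k = 1 / (Gamma (real k + \<mu>) * fact k)" for k
  have "diffs c k = 1 / (Gamma (real k + (\<mu> + 1)) * fact k)" for k
    by (simp add: c_def diffs_def add_ac del: of_nat_Suc)
       (simp add: add_ac)
  then show ?thesis
    using termdiffs_strong_converges_everywhere[of c x] summable_bessel_series[OF assms]
    by (simp add: c_def bessel_series_def[abs_def])
qed

lemma bessel_series_recurrence:
  assumes "0 < \<mu>"
  shows "bessel_series \<mu> x = \<mu> * bessel_series (\<mu> + 1) x + x * bessel_series (\<mu> + 2) x"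
proof -
  let ?a = "\<lambda>\<mu> k. 1 / (Gamma (real k + \<mu>) * fact k) * x ^ k"
  have s: "?a \<nu> sums bessel_series \<nu> x" if "0 < \<nu>" for \<nu>
    using summable_bessel_series[OF that] by (simp add: bessel_series_def summable_sums)
  have "(\<lambda>k. ?a \<mu> k - \<mu> * ?a (\<mu> + 1) k) sums (bessel_series \<mu> x - \<mu> * bessel_series (\<mu> + 1) x)"
    using assms by (intro sums_diff sums_mult s) auto
  \<comment> \<open>By the functional equation of Gamma the difference of coefficients carries a
    factor \<open>k\<close>. It kills the constant term and otherwise reduces \<open>fact k\<close>
    to \<open>fact (k - 1)\<close>, so what remains is a shifted series.\<close>
  moreover have "?a \<mu> k - \<mu> * ?a (\<mu> + 1) k = (if k = 0 then 0 else x * ?a (\<mu> + 2) (k - 1))" for k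
  proof -
    have G: "Gamma (real k + (\<mu> + 1)) = (real k + \<mu>) * Gamma (real k + \<mu>)"
      using Gamma_plus1[of "real k + \<mu>"] assms
      by (auto simp: algebra_simps nonpos_Ints_def)
    have pos: "Gamma (real k + \<mu>) > 0" using assms by (intro Gamma_real_pos) auto
    have eq: "?a \<mu> k - \<mu> * ?a (\<mu> + 1) k = real k / (Gamma (real k + (\<mu> + 1)) * fact k) * x ^ k"
      unfolding G using pos assms by (simp add: divide_simps) (simp add: algebra_simps)
    show ?thesis
    proof (cases k)
      case (Suc j)
      show ?thesis unfolding eq
        unfolding Suc by (simp add: add_ac del: of_nat_Suc) (simp add: add_ac)
    qed (use eq in simp)
  qed
  ultimately have "(\<lambda>k. if k = 0 then 0 else x * ?a (\<mu> + 2) (k - 1))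
      sums (bessel_series \<mu> x - \<mu> * bessel_series (\<mu> + 1) x)"
    by simp
  then have "(\<lambda>k. x * ?a (\<mu> + 2) k) sums (bessel_series \<mu> x - \<mu> * bessel_series (\<mu> + 1) x)"
    using sums_Suc_iff[of "\<lambda>k. if k = 0 then 0 else x * ?a (\<mu> + 2) (k - 1)"] by simp
  moreover have "(\<lambda>k. x * ?a (\<mu> + 2) k) sums (x * bessel_series (\<mu> + 2) x)"
    using assms by (intro sums_mult s) auto
  ultimately show ?thesis
    using sums_unique2 by fastforce
qed

text \<open>Positivity of \<open>x\<close> lets the real power split into a fractional and a natural
  part; the bound on \<open>\<nu>\<close> keeps the parameter \<open>\<nu> + 1\<close> in the range
  where the series is known to converge.\<close>

lemma bessel_I_eq_bessel_series:
  assumes "0 < x" "- 1 < \<nu>"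
  shows "bessel_I \<nu> x = (x / 2) powr \<nu> * bessel_series (\<nu> + 1) ((x / 2)\<^sup>2)"
proof -
  have "(x / 2) powr (2 * real k + \<nu>) = (x / 2) powr \<nu> * ((x / 2)\<^sup>2) ^ k" for k
    using assms(1) by (simp add: powr_add powr_realpow flip: power_mult)
      (metis assms(1) half_gt_zero of_nat_mult of_nat_numeral powr_realpow)
  then have "bessel_I \<nu> x =
      (\<Sum>k. (x / 2) powr \<nu> * (1 / (Gamma (real k + (\<nu> + 1)) * fact k) * ((x / 2)\<^sup>2) ^ k))"
    unfolding bessel_I_def by (intro suminf_cong) (simp add: add_ac)
  also have "\<dots> = (x / 2) powr \<nu> * bessel_series (\<nu> + 1) ((x / 2)\<^sup>2)"
    unfolding bessel_series_def using assms
    by (intro suminf_mult summable_bessel_series) auto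
  finally show ?thesis .
qed

section \<open>Closed forms of the moments and their differential equations\<close>

definition even_moment :: "real \<Rightarrow> nat \<Rightarrow> real \<Rightarrow> real" where
  "even_moment l m t = Gamma (real m + 1 / 2) * t ^ (2 * m) * exp (- (l * t)) *
    (bessel_series (real m + 1 / 2) ((l * t / 2)\<^sup>2)
      + l * t / 2 * bessel_series (real m + 3 / 2) ((l * t / 2)\<^sup>2))"

text \<open>The candidates for \<open>u_(2m)\<close> and \<open>w_(2m+1)\<close> are written without
  fractional powers, so that they are smooth at 0 and can be integrated from there.\<close>

definition odd_moment :: "real \<Rightarrow> nat \<Rightarrow> real \<Rightarrow> real" where
  "odd_moment l m t = Gamma (real m + 3 / 2) * t ^ (2 * m + 1) * exp (- (l * t)) *
    bessel_series (real m + 3 / 2) ((l * t / 2)\<^sup>2)"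

text \<open>The parameter \<open>\<nu>\<close> is kept apart from \<open>\<mu> + 1\<close> so that
  concrete values such as 5/2 match without rearrangement.\<close>

lemma DERIV_bessel_series_square:
  assumes "0 < \<mu>" "\<mu> + 1 = \<nu>"
  shows "((\<lambda>t. bessel_series \<mu> ((l * t / 2)\<^sup>2)) has_real_derivative
    bessel_series \<nu> ((l * t / 2)\<^sup>2) * (l\<^sup>2 * t / 2)) (at t)"
proof -
  have "((\<lambda>t. (l * t / 2)\<^sup>2) has_real_derivative l\<^sup>2 * t / 2) (at t)"
    by (auto intro!: derivative_eq_intros simp: power2_eq_square)
  from DERIV_chain2[OF DERIV_bessel_series[OF assms(1)] this] show ?thesis
    using assms(2) by simp
qed

text \<open>The parameters 1/2 and 3/2 give cosh and sinh, so this is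
  \<open>exp (-x) * (cosh x + sinh x) = 1\<close> in disguise. The proof shows that the derivative
  vanishes and evaluates at 0.\<close>

lemma even_moment_0: "even_moment l 0 t = 1"
proof -
  have "(even_moment l 0 has_real_derivative 0) (at s)" for s
  proof -
    define c f g h where "c = l / 2" and "f = (\<lambda>s. bessel_series (1/2) ((l * s / 2)\<^sup>2))"
      and "g = (\<lambda>s. bessel_series (3/2) ((l * s / 2)\<^sup>2))"
      and "h = (\<lambda>s. bessel_series (5/2) ((l * s / 2)\<^sup>2))"
    \<comment> \<open>Eliminating the lowest parameter turns the derivative condition into a
      polynomial identity in \<open>g\<close> and \<open>h\<close>; the next two derivative lemmas
      use the same device.\<close>
    have f: "f s = g s / 2 + (l * s / 2)\<^sup>2 * h s"
      using bessel_series_recurrence[of "1/2" "(l * s / 2)\<^sup>2"] by (simp add: f_def g_def h_def)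
    have D: "(f has_real_derivative g s * (l\<^sup>2 * s / 2)) (at s)"
      "(g has_real_derivative h s * (l\<^sup>2 * s / 2)) (at s)"
      unfolding f_def g_def h_def by (rule DERIV_bessel_series_square; simp)+
    have e: "even_moment l 0 = (\<lambda>s. Gamma (1/2) * exp (- (l * s)) * (f s + c * s * g s))"
      by (simp add: even_moment_def c_def f_def g_def fun_eq_iff)
    show ?thesis
      unfolding e
      by (rule derivative_eq_intros D refl)+ (simp add: c_def f algebra_simps power2_eq_square)
  qed
  then have "even_moment l 0 t = even_moment l 0 0"
    using DERIV_isconst_all by blast
  then show ?thesis
    by (simp add: even_moment_def bessel_series_0 Gamma_one_half_real)
qed

text \<open>Differential form of the step from \<open>w_(2m+1)\<close> to \<open>u_(2m+2)\<close>:
  the recurrence cancels everything that the exponential factor contributes except one Bessel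
  term.\<close>

lemma DERIV_even_moment:
  "(even_moment l (Suc m) has_real_derivative real (2 * m + 2) * odd_moment l m t) (at t)"
proof -
  define c f g h where "c = l / 2" and "f = (\<lambda>t. bessel_series (real m + 3/2) ((l * t / 2)\<^sup>2))"
    and "g = (\<lambda>t. bessel_series (real m + 5/2) ((l * t / 2)\<^sup>2))"
    and "h = (\<lambda>t. bessel_series (real m + 7/2) ((l * t / 2)\<^sup>2))"
  have f: "f t = (real m + 3/2) * g t + (l * t / 2)\<^sup>2 * h t"
    using bessel_series_recurrence[of "real m + 3/2" "(l * t / 2)\<^sup>2"]
    by (simp add: f_def g_def h_def add_ac)
  have D: "(f has_real_derivative g t * (l\<^sup>2 * t / 2)) (at t)"
    "(g has_real_derivative h t * (l\<^sup>2 * t / 2)) (at t)"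
    unfolding f_def g_def h_def by (rule DERIV_bessel_series_square; simp)+
  have e: "even_moment l (Suc m) =
      (\<lambda>t. Gamma (real m + 3/2) * t ^ (2 * m + 2) * exp (- (l * t)) * (f t + c * t * g t))"
    by (simp add: even_moment_def c_def f_def g_def fun_eq_iff add_ac)
  have o: "odd_moment l m t = Gamma (real m + 3/2) * t ^ (2 * m + 1) * exp (- (l * t)) * f t"
    by (simp add: odd_moment_def f_def)
  show ?thesis
    unfolding e o
    by (rule derivative_eq_intros D refl)+ (simp add: c_def f field_simps power2_eq_square)
qed

text \<open>Differential form of the step from \<open>u_(2m)\<close> to \<open>w_(2m+1)\<close>; the
  damping term with \<open>2 * l\<close> reflects the decay \<open>exp (-2 * l * t)\<close> of the
  mean sign.\<close>

lemma DERIV_odd_moment: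
  "(odd_moment l m has_real_derivative
    real (2 * m + 1) * even_moment l m t - 2 * l * odd_moment l m t) (at t)"
proof -
  define f g h where "f = (\<lambda>t. bessel_series (real m + 1/2) ((l * t / 2)\<^sup>2))"
    and "g = (\<lambda>t. bessel_series (real m + 3/2) ((l * t / 2)\<^sup>2))"
    and "h = (\<lambda>t. bessel_series (real m + 5/2) ((l * t / 2)\<^sup>2))"
  have f: "f t = (real m + 1/2) * g t + (l * t / 2)\<^sup>2 * h t"
    using bessel_series_recurrence[of "real m + 1/2" "(l * t / 2)\<^sup>2"]
    by (simp add: f_def g_def h_def add_ac)
  have D: "(g has_real_derivative h t * (l\<^sup>2 * t / 2)) (at t)"
    unfolding g_def h_def by (rule DERIV_bessel_series_square; simp)
  have G: "Gamma (real m + 3/2) = (real m + 1/2) * Gamma (real m + 1/2)"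
    using Gamma_plus1[of "real m + 1/2"] by (auto simp: add_ac nonpos_Ints_def)
  have e: "even_moment l m t =
      Gamma (real m + 1/2) * t ^ (2 * m) * exp (- (l * t)) * (f t + l * t / 2 * g t)"
    by (simp add: even_moment_def f_def g_def)
  have o: "odd_moment l m =
      (\<lambda>t. (real m + 1/2) * Gamma (real m + 1/2) * t ^ (2 * m + 1) * exp (- (l * t)) * g t)"
    by (simp add: odd_moment_def g_def fun_eq_iff G)
  show ?thesis
    unfolding e o
    by (rule derivative_eq_intros D refl)+ (simp add: f field_simps power2_eq_square)
qed

text \<open>Variation of constants for the preceding equation: the exponential is the integrating
  factor, and the boundary term at 0 vanishes because of the factor
  \<open>t ^ (2 * m + 1)\<close>.\<close>

lemma odd_moment_eq_integral:
  assumes "0 \<le> t"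
  shows "((\<lambda>s. exp (- (2 * l * (t - s))) * even_moment l m s)
    has_integral odd_moment l m t / real (2 * m + 1)) {0..t}"
proof -
  let ?F = "\<lambda>s. exp (- (2 * l * (t - s))) * odd_moment l m s / real (2 * m + 1)"
  have "(?F has_real_derivative exp (- (2 * l * (t - s))) * even_moment l m s) (at s)" for s
  proof -
    have "((\<lambda>s. exp (- (2 * l * (t - s))) * odd_moment l m s) has_real_derivative
        real (2 * m + 1) * (exp (- (2 * l * (t - s))) * even_moment l m s)) (at s)"
      by (rule derivative_eq_intros DERIV_odd_moment refl)+ (simp add: algebra_simps)
    from DERIV_cdivide[OF this, of "real (2 * m + 1)"] show ?thesis by simp
  qed
  then have "((\<lambda>s. exp (- (2 * l * (t - s))) * even_moment l m s) has_integral ?F t - ?F 0) {0..t}"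
    using assms
    by (intro fundamental_theorem_of_calculus)
      (auto intro: DERIV_subset simp flip: has_real_derivative_iff_has_vector_derivative)
  then show ?thesis
    by (simp add: odd_moment_def)
qed

lemma even_moment_eq_integral:
  assumes "0 \<le> t"
  shows "(odd_moment l m has_integral even_moment l (Suc m) t / real (2 * m + 2)) {0..t}"
proof -
  have "((\<lambda>s. even_moment l (Suc m) s / real (2 * m + 2)) has_real_derivative odd_moment l m s) (at s)" for s
    using DERIV_cdivide[OF DERIV_even_moment[of l m s], of "real (2 * m + 2)"] by simp
  then have "(odd_moment l m has_integral
      even_moment l (Suc m) t / real (2 * m + 2) - even_moment l (Suc m) 0 / real (2 * m + 2)) {0..t}"
    using assms
    by (intro fundamental_theorem_of_calculus)
      (auto intro: DERIV_subset simp flip: has_real_derivative_iff_has_vector_derivative)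
  then show ?thesis
    by (simp add: even_moment_def)
qed

lemma even_moment_eq_bessel_I:
  assumes "0 < l" "0 < t"
  shows "even_moment l m t = t ^ (2 * m) * (2 / (l * t)) powr (real m - 1 / 2) * Gamma (real m + 1 / 2)
      * (bessel_I (real m + 1 / 2) (l * t) + bessel_I (real m - 1 / 2) (l * t)) * exp (- (l * t))"
proof -
  have pos: "0 < l * t" using assms by simp
  let ?x = "(l * t / 2)\<^sup>2"
  \<comment> \<open>The two bases are reciprocal, so the prefactor of the claimed formula exactly
    removes the fractional power contained in the Bessel functions.\<close>
  have 1: "(2 / (l * t)) powr (real m - 1 / 2) * (l * t / 2) powr (real m - 1 / 2) = 1"
    using pos by (subst powr_mult[symmetric]) (auto simp: field_simps)
  have 2: "(l * t / 2) powr (real m + 1 / 2) = (l * t / 2) * (l * t / 2) powr (real m - 1 / 2)"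
    using pos powr_add[of "l * t / 2" 1 "real m - 1 / 2"] by (simp add: add.commute)
  have b: "bessel_I (real m + 1 / 2) (l * t) = (l * t / 2) * (l * t / 2) powr (real m - 1 / 2) * bessel_series (real m + 3/2) ?x"
    "bessel_I (real m - 1 / 2) (l * t) = (l * t / 2) powr (real m - 1 / 2) * bessel_series (real m + 1/2) ?x"
    using bessel_I_eq_bessel_series[OF pos, of "real m + 1/2"] bessel_I_eq_bessel_series[OF pos, of "real m - 1/2"] 2
    by (simp_all add: add_ac)
  have "t ^ (2 * m) * (2 / (l * t)) powr (real m - 1 / 2) * Gamma (real m + 1 / 2)
      * (bessel_I (real m + 1 / 2) (l * t) + bessel_I (real m - 1 / 2) (l * t)) * exp (- (l * t))
    = ((2 / (l * t)) powr (real m - 1 / 2) * (l * t / 2) powr (real m - 1 / 2)) * even_moment l m t"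
    unfolding b even_moment_def by (simp add: algebra_simps)
  then show ?thesis unfolding 1 by simp
qed

subsection \<open>Deterministic counting paths\<close>

text \<open>This is Y(t) along one fixed path. Separating it from the probability space makes its
  calculus deterministic.\<close>

definition sgn_path :: "(real \<Rightarrow> nat) \<Rightarrow> real \<Rightarrow> real" where
  "sgn_path n t = (LINT s:{0..t}|lborel. (- 1) ^ n s)"

lemma eventually_at_right_eq:
  fixes n :: "real \<Rightarrow> nat"
  assumes "continuous (at_right t) n"
  shows "eventually (\<lambda>s. n s = n t) (at_right t)"
  using assms by (auto simp: continuous_within tendsto_discrete)

text \<open>Values in a discrete space turn right-continuity into equality on a right neighbourhood,
  and the sequence eventually stays in it.\<close>

lemma right_continuous_tendsto:
  fixes n :: "real \<Rightarrow> nat"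
  assumes "continuous (at_right t) n" and x: "x \<longlonglongrightarrow> t" "\<And>i. t \<le> x i"
  shows "eventually (\<lambda>i. n (x i) = n t) sequentially"
proof -
  obtain b where b: "t < b" "\<And>y. t < y \<Longrightarrow> y < b \<Longrightarrow> n y = n t"
    using eventually_at_right_eq[OF assms(1)] by (auto simp: eventually_at_right_field)
  have "eventually (\<lambda>i. x i < b) sequentially"
    using x(1) b(1) by (rule order_tendstoD)
  then show ?thesis
    by eventually_elim (metis b(2) x(2) le_less)
qed

text \<open>Rounding up to a grid gives approximants with countably many values that never lie left
  of \<open>s\<close>, as right-continuity demands.\<close>

lemma grid_tendsto: "(\<lambda>n. real_of_int \<lceil>real (Suc n) * s\<rceil> / real (Suc n)) \<longlonglongrightarrow> s"
proof (rule tendsto_sandwich[OF _ _ tendsto_const])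
  show "eventually (\<lambda>n. s \<le> real_of_int \<lceil>real (Suc n) * s\<rceil> / real (Suc n)) sequentially"
    by (simp add: field_simps)
  show "eventually (\<lambda>n. real_of_int \<lceil>real (Suc n) * s\<rceil> / real (Suc n) \<le> s + 1 / real (Suc n)) sequentially"
  proof (intro always_eventually allI)
    fix n
    have "real_of_int \<lceil>x\<rceil> \<le> x + 1" for x by linarith
    from this[of "real (Suc n) * s"] show "real_of_int \<lceil>real (Suc n) * s\<rceil> / real (Suc n) \<le> s + 1 / real (Suc n)"
      by (simp add: field_simps del: of_nat_Suc)
  qed
  show "(\<lambda>n. s + 1 / real (Suc n)) \<longlonglongrightarrow> s"
    using tendsto_add[OF tendsto_const LIMSEQ_inverse_real_of_nat, of s] by (simp add: inverse_eq_divide)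
qed

locale counting_path =
  fixes n :: "real \<Rightarrow> nat"
  assumes mono: "mono_on {0..} n"
    and right_cont: "\<And>t. 0 \<le> t \<Longrightarrow> continuous (at_right t) n"
begin

lemma borel_measurable_sgn: "(\<lambda>s. indicator {0..t} s * (- 1) ^ n s :: real) \<in> borel_measurable borel"
proof -
  \<comment> \<open>Clipping the time at 0 extends monotonicity to the whole line, so that monotone
    functions being Borel applies; the floor below recovers the natural exponent.\<close>
  have "mono (\<lambda>s. real (n (max 0 s)))"
    using mono by (auto simp: mono_on_def intro!: monoI)
  then have m: "(\<lambda>s. real (n (max 0 s))) \<in> borel_measurable borel"
    by (rule borel_measurable_mono)
  have "(\<lambda>s. indicator {0..t} s * (- 1) ^ nat \<lfloor>real (n (max 0 s))\<rfloor> :: real) \<in> borel_measurable borel"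
    using m by measurable
  also have "(\<lambda>s. indicator {0..t} s * (- 1) ^ nat \<lfloor>real (n (max 0 s))\<rfloor> :: real) = (\<lambda>s. indicator {0..t} s * (- 1) ^ n s :: real)"
    by (auto simp: fun_eq_iff indicator_def max_def)
  finally show ?thesis .
qed

lemma set_integrable_sgn: "set_integrable lborel {0..t} (\<lambda>s. (- 1) ^ n s :: real)"
  unfolding set_integrable_def
proof (rule Bochner_Integration.integrable_bound[where f = "indicator {0..t} :: real \<Rightarrow> real"])
  show "(\<lambda>s. indicator {0..t} s *\<^sub>R (- 1) ^ n s :: real) \<in> borel_measurable lborel"
    using borel_measurable_sgn by simp
qed (auto simp: power_abs indicator_def emeasure_lborel_Icc_eq intro!: integrable_real_indicator)

lemma sgn_path_eq_integral: "sgn_path n t = integral {0..t} (\<lambda>s. (- 1) ^ n s)"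
  unfolding sgn_path_def by (rule set_borel_integral_eq_integral[OF set_integrable_sgn])

lemma sgn_integrable_on: "(\<lambda>s. (- 1) ^ n s :: real) integrable_on {0..t}"
  by (rule set_borel_integral_eq_integral[OF set_integrable_sgn])

lemma abs_sgn_path_le:
  assumes "0 \<le> t"
  shows "\<bar>sgn_path n t\<bar> \<le> t"
proof -
  have "norm (integral {0..t} (\<lambda>s. (- 1) ^ n s :: real)) \<le> integral {0..t} (\<lambda>_. 1 :: real)"
    by (rule integral_norm_bound_integral[OF sgn_integrable_on]) (auto simp: power_abs)
  then show ?thesis
    using assms by (simp add: sgn_path_eq_integral)
qed

lemma continuous_on_sgn_path: "continuous_on {0..t} (sgn_path n)"
  unfolding sgn_path_eq_integral[abs_def]
  by (rule indefinite_integral_continuous_1[OF sgn_integrable_on])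

lemma DERIV_sgn_path:
  assumes s: "0 < s" and ev: "eventually (\<lambda>u. n u = n s) (at s)"
  shows "(sgn_path n has_real_derivative (- 1) ^ n s) (at s)"
proof -
  have "((\<lambda>u. (- 1) ^ n u :: real) \<longlongrightarrow> (- 1) ^ n s) (at s)"
    by (rule tendsto_eventually) (use ev in eventually_elim, simp)
  then have "continuous (at s within ({0..s + 1} - {})) (\<lambda>u. (- 1) ^ n u :: real)"
    by (auto simp: continuous_within intro: tendsto_within_subset)
  then have "((\<lambda>u. integral {0..u} (\<lambda>u. (- 1) ^ n u :: real)) has_vector_derivative (- 1) ^ n s)
      (at s within ({0..s + 1} - {}))"
    using s by (intro integral_has_vector_derivative_continuous_at sgn_integrable_on) auto
  then have "(sgn_path n has_vector_derivative (- 1) ^ n s) (at s within {0..s+1})"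
    by (simp add: sgn_path_eq_integral[abs_def])
  moreover have "at s within {0..s+1} = at s"
    using s by (intro at_within_interior) auto
  ultimately show ?thesis
    by (simp add: has_real_derivative_iff_has_vector_derivative)
qed

text \<open>Distinct jump times carry distinct values of \<open>n\<close>, and up to time
  \<open>t\<close> only the values \<open>0, ..., n t\<close> are available.\<close>

lemma finite_jumps: "finite {s \<in> {0<..<t}. \<not> eventually (\<lambda>u. n u = n s) (at s)}"
proof -
  let ?S = "{s \<in> {0<..<t}. \<not> eventually (\<lambda>u. n u = n s) (at s)}"
  \<comment> \<open>With equal values, monotonicity makes \<open>n\<close> constant on
    \<open>(s, s')\<close>. Together with right-continuity at \<open>s'\<close> this makes
    \<open>n\<close> locally constant there, so \<open>s'\<close> is not a jump.\<close>
  have no: "n s \<noteq> n s'" if "s \<in> ?S" "s' \<in> ?S" "s < s'" for s s'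
  proof
    assume eq: "n s = n s'"
    have "n u = n s'" if "s < u" "u < s'" for u
    proof (rule antisym)
      show "n u \<le> n s'"
        using mono that \<open>s \<in> ?S\<close> by (auto simp: mono_on_def)
      show "n s' \<le> n u"
        unfolding eq[symmetric] using mono that \<open>s \<in> ?S\<close> by (auto simp: mono_on_def)
    qed
    then have "eventually (\<lambda>u. n u = n s') (at_left s')"
      using \<open>s < s'\<close> by (auto simp: eventually_at_left_field)
    moreover have "eventually (\<lambda>u. n u = n s') (at_right s')"
      using that by (intro eventually_at_right_eq right_cont) auto
    ultimately show False
      using \<open>s' \<in> ?S\<close> by (auto simp: eventually_at_split)
  qed
  have "inj_on n ?S"
  proof (rule inj_onI)
    fix s s' assume "s \<in> ?S" "s' \<in> ?S" "n s = n s'"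
    then show "s = s'"
      using no[of s s'] no[of s' s] by (cases s s' rule: linorder_cases) simp_all
  qed
  moreover have "n ` ?S \<subseteq> {..n t}"
    using mono by (auto simp: mono_on_def)
  ultimately show ?thesis
    by (meson finite_atMost finite_imageD finite_subset)
qed

text \<open>The fundamental theorem of calculus holds off the finitely many jumps because Y is
  continuous. The value at 0 drops out since the exponent is positive.\<close>

lemma sgn_path_power_has_integral:
  assumes "0 \<le> t"
  shows "((\<lambda>s. real (Suc k) * (sgn_path n s ^ k * (- 1) ^ n s)) has_integral sgn_path n t ^ Suc k) {0..t}"
proof -
  have "((\<lambda>s. real (Suc k) * (sgn_path n s ^ k * (- 1) ^ n s)) has_integral
      sgn_path n t ^ Suc k - sgn_path n 0 ^ Suc k) {0..t}"
  proof (rule fundamental_theorem_of_calculus_interior_strong[OF finite_jumps assms])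
    fix s assume s: "s \<in> {0<..<t} - {s \<in> {0<..<t}. \<not> eventually (\<lambda>u. n u = n s) (at s)}"
    then have D: "(sgn_path n has_real_derivative (- 1) ^ n s) (at s)"
      by (intro DERIV_sgn_path) auto
    have "((\<lambda>s. sgn_path n s ^ Suc k) has_real_derivative
        real (Suc k) * (sgn_path n s ^ k * (- 1) ^ n s)) (at s)"
      by (rule derivative_eq_intros D refl)+ simp
    then show "((\<lambda>s. sgn_path n s ^ Suc k) has_vector_derivative
        real (Suc k) * (sgn_path n s ^ k * (- 1) ^ n s)) (at s)"
      by (simp add: has_real_derivative_iff_has_vector_derivative)
  qed (intro continuous_intros continuous_on_sgn_path)
  then show ?thesis
    by (simp add: sgn_path_eq_integral)
qed

text \<open>
  Riemann sums involve only finitely many values of the path, so that independence and measurability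
  of the increments pass to the limit. Right-continuity requires right endpoints.
\<close>

definition riemann_sgn :: "nat \<Rightarrow> real \<Rightarrow> real" where
  "riemann_sgn m t = (\<Sum>i<Suc m. t / real (Suc m) * (- 1) ^ n (t * real (Suc i) / real (Suc m)))"

lemma abs_riemann_sgn_le:
  assumes "0 \<le> t"
  shows "\<bar>riemann_sgn m t\<bar> \<le> t"
proof -
  have "\<bar>riemann_sgn m t\<bar> \<le> (\<Sum>i<Suc m. t / real (Suc m))"
    unfolding riemann_sgn_def using assms
    by (intro order_trans[OF sum_abs] sum_mono) (simp add: abs_mult power_abs)
  also have "\<dots> = t"
    by (simp del: of_nat_Suc sum.lessThan_Suc)
  finally show ?thesis .
qed

text \<open>The sum is the integral of the step function \<open>f m\<close>, which samples the path
  at the next grid point to the right. Right-continuity gives pointwise convergence and dominated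
  convergence does the rest.\<close>

lemma riemann_sgn_tendsto:
  assumes "0 < t"
  shows "(\<lambda>m. riemann_sgn m t) \<longlonglongrightarrow> sgn_path n t"
proof -
  define I where "I m i = {t * real i / real (Suc m)<..t * real (Suc i) / real (Suc m)}" for m i
  define f where "f m s = (\<Sum>i<Suc m. indicator (I m i) s * (- 1) ^ n (t * real (Suc i) / real (Suc m)) :: real)" for m s
  have f_eq: "f m s = indicator {0<..t} s * (- 1) ^ n (t * (real_of_int \<lceil>real (Suc m) * (s / t)\<rceil> / real (Suc m)))" for m s
  proof (cases "s \<in> {0<..t}")
    case True
    define c where "c = nat \<lceil>real (Suc m) * (s / t)\<rceil>"
    have c1: "real_of_int \<lceil>real (Suc m) * (s / t)\<rceil> = real c" "0 < c"
      using True assms by (auto simp: c_def)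
    have "real (Suc m) * (s / t) \<le> real (Suc m)"
      using True assms by (intro mult_left_le) auto
    then have c2: "c \<le> Suc m"
      unfolding c_def by linarith
    \<comment> \<open>Cells are open on the left and closed on the right, so the cell containing
      \<open>s\<close> has the ceiling \<open>c\<close> as right end and index
      \<open>c - 1\<close>.\<close>
    have mem: "s \<in> I m i \<longleftrightarrow> i = c - 1" for i
    proof -
      have "s \<in> I m i \<longleftrightarrow> real i < real (Suc m) * (s / t) \<and> real (Suc m) * (s / t) \<le> real (Suc i)"
        unfolding I_def using assms by (auto simp: field_simps simp del: of_nat_Suc)
      also have "\<dots> \<longleftrightarrow> c = Suc i"
        using c1 by linarith
      finally show ?thesis using c1 by auto
    qed
    have "f m s = (\<Sum>i<Suc m. if i = c - 1 then (- 1) ^ n (t * real (Suc i) / real (Suc m)) else 0)"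
      unfolding f_def by (intro sum.cong) (auto simp: mem indicator_def)
    also have "\<dots> = (- 1) ^ n (t * real c / real (Suc m))"
      using c1 c2 by (simp add: sum.delta del: of_nat_Suc sum.lessThan_Suc)
    finally show ?thesis
      using True c1 by simp
  next
    case False
    have "I m i \<subseteq> {0<..t}" if "i < Suc m" for i
    proof -
      have "0 \<le> t * real i / real (Suc m)" using assms by simp
      moreover have "t * real (Suc i) / real (Suc m) \<le> t"
        using assms that by (simp add: field_simps del: of_nat_Suc)
      ultimately show ?thesis unfolding I_def by auto
    qed
    then have "s \<notin> I m i" if "i < Suc m" for i
      using that False by blast
    then have "f m s = 0"
      unfolding f_def by (intro sum.neutral) auto
    with False show ?thesis by simp
  qed
  have "(\<lambda>s. indicator {0<..t} s * (indicator {0..t} s * (- 1) ^ n s) :: real) \<in> borel_measurable borel"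
    using borel_measurable_sgn[of t] by measurable
  moreover have "(\<lambda>s. indicator {0<..t} s * (indicator {0..t} s * (- 1) ^ n s) :: real)
      = (\<lambda>s. indicator {0<..t} s * (- 1) ^ n s)"
    by (auto simp: fun_eq_iff indicator_def)
  ultimately have meas: "(\<lambda>s. indicator {0<..t} s * (- 1) ^ n s :: real) \<in> borel_measurable lborel"
    by simp
  have "(\<lambda>m. integral\<^sup>L lborel (f m)) \<longlonglongrightarrow> integral\<^sup>L lborel (\<lambda>s. indicator {0<..t} s * (- 1) ^ n s :: real)"
  proof (rule integral_dominated_convergence[where w = "indicator {0..t}"])
    show "(\<lambda>s. indicator {0<..t} s * (- 1) ^ n s :: real) \<in> borel_measurable lborel"
      by (rule meas)
    show "f m \<in> borel_measurable lborel" for m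
      unfolding f_def[abs_def] I_def by measurable
    show "integrable lborel (indicator {0..t} :: real \<Rightarrow> real)"
      by (intro integrable_real_indicator) (auto simp: emeasure_lborel_Icc_eq)
    show "AE s in lborel. norm (f m s) \<le> indicator {0..t} s" for m
      unfolding f_eq by (auto simp: indicator_def power_abs)
    show "AE s in lborel. (\<lambda>m. f m s) \<longlonglongrightarrow> indicator {0<..t} s * (- 1) ^ n s"
    proof (intro AE_I2)
      fix s
      show "(\<lambda>m. f m s) \<longlonglongrightarrow> indicator {0<..t} s * (- 1) ^ n s"
      proof (cases "s \<in> {0<..t}")
        case True
        let ?g = "\<lambda>m. t * (real_of_int \<lceil>real (Suc m) * (s / t)\<rceil> / real (Suc m))"
        have "?g \<longlonglongrightarrow> t * (s / t)"
          by (intro tendsto_intros grid_tendsto)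
        then have "?g \<longlonglongrightarrow> s" using assms by simp
        moreover have "s \<le> ?g m" for m
        proof -
          have "s = t * (real (Suc m) * (s / t) / real (Suc m))"
            using assms by simp
          also have "\<dots> \<le> ?g m"
            using assms by (intro mult_left_mono divide_right_mono le_of_int_ceiling) auto
          finally show ?thesis .
        qed
        ultimately have "eventually (\<lambda>m. n (?g m) = n s) sequentially"
          using True by (intro right_continuous_tendsto right_cont) auto
        then show ?thesis
          unfolding f_eq by (intro tendsto_eventually, elim eventually_mono) simp
      qed (simp add: f_eq)
    qed
  qed
  moreover have "integral\<^sup>L lborel (f m) = riemann_sgn m t" for m
  proof -
    have "integral\<^sup>L lborel (f m) = (\<Sum>i<Suc m. \<integral>s. indicator (I m i) s * (- 1) ^ n (t * real (Suc i) / real (Suc m)) \<partial>lborel :: real)"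
      unfolding f_def by (intro Bochner_Integration.integral_sum integrable_mult_left integrable_real_indicator)
        (use assms in \<open>auto simp: I_def divide_right_mono mult_left_mono\<close>)
    also have "\<dots> = riemann_sgn m t"
      unfolding riemann_sgn_def using assms
      by (intro sum.cong) (auto simp: I_def divide_simps simp del: of_nat_Suc, simp add: algebra_simps)
    finally show ?thesis .
  qed
  \<comment> \<open>The half-open cells miss only the null set consisting of the point 0.\<close>
  moreover have "integral\<^sup>L lborel (\<lambda>s. indicator {0<..t} s * (- 1) ^ n s :: real) = sgn_path n t"
    unfolding sgn_path_def set_lebesgue_integral_def
  proof (rule integral_cong_AE[OF meas])
    show "AE s in lborel. indicator {0<..t} s * (- 1) ^ n s = indicator {0..t} s *\<^sub>R ((- 1) ^ n s :: real)"
      using AE_lborel_singleton[of 0] by eventually_elim (auto simp: indicator_def)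
  qed (use borel_measurable_sgn in simp)
  ultimately show ?thesis by simp
qed

end

subsection \<open>The Poisson process\<close>

text \<open>Fubini for a bounded integrand on a set of finite measure. Pathwise integrals are gauge
  integrals, so they are first identified with Lebesgue integrals and the result is converted
  back.\<close>

lemma (in prob_space) has_integral_expectation:
  fixes f :: "real \<Rightarrow> 'a \<Rightarrow> real"
  assumes [measurable]: "case_prod f \<in> borel_measurable (borel \<Otimes>\<^sub>M M)"
    and bound: "\<And>s \<omega>. s \<in> {0..t} \<Longrightarrow> \<omega> \<in> space M \<Longrightarrow> \<bar>f s \<omega>\<bar> \<le> C"
    and F: "\<And>\<omega>. \<omega> \<in> space M \<Longrightarrow> ((\<lambda>s. f s \<omega>) has_integral F \<omega>) {0..t}"
  shows "((\<lambda>s. expectation (f s)) has_integral expectation F) {0..t}"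
proof -
  interpret P: pair_sigma_finite lborel M ..
  have [measurable]: "case_prod f \<in> borel_measurable (lborel \<Otimes>\<^sub>M M)"
    using assms(1) by (simp cong: measurable_cong_sets sets_pair_measure_cong)
  have int: "integrable (lborel \<Otimes>\<^sub>M M) (\<lambda>(s, \<omega>). indicator {0..t} s * f s \<omega>)"
  proof (rule integrableI_bounded_set[where A = "{0..t} \<times> space M" and B = C])
    show "emeasure (lborel \<Otimes>\<^sub>M M) ({0..t} \<times> space M) < \<infinity>"
      by (subst emeasure_pair_measure_Times) (auto simp: emeasure_space_1 emeasure_lborel_Icc_eq)
    show "AE x\<in>{0..t} \<times> space M in lborel \<Otimes>\<^sub>M M. norm (case x of (s, \<omega>) \<Rightarrow> indicator {0..t} s * f s \<omega>) \<le> C"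
      using bound by (intro AE_I2) (auto simp: indicator_def)
  qed (auto simp: indicator_def space_pair_measure)
  have "F \<omega> = (\<integral>s. indicator {0..t} s * f s \<omega> \<partial>lborel)" if \<omega>: "\<omega> \<in> space M" for \<omega>
  proof -
    have [measurable]: "(\<lambda>s. f s \<omega>) \<in> borel_measurable lborel"
      using measurable_compose[OF measurable_Pair2', of \<omega> M "case_prod f" lborel borel] \<omega> by simp
    have "integrable lborel (\<lambda>s. indicator {0..t} s * f s \<omega>)"
      by (rule integrableI_bounded_set[where A = "{0..t}" and B = C])
        (use bound \<omega> in \<open>auto simp: emeasure_lborel_Icc_eq indicator_def\<close>)
    then have "set_integrable lborel {0..t} (\<lambda>s. f s \<omega>)"
      by (simp add: set_integrable_def)
    from set_borel_integral_eq_integral[OF this] F[OF \<omega>] show ?thesis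
      by (simp add: integral_unique set_lebesgue_integral_def)
  qed
  then have "expectation F = (\<integral>\<omega>. (\<integral>s. indicator {0..t} s * f s \<omega> \<partial>lborel) \<partial>M)"
    by (intro Bochner_Integration.integral_cong) auto
  also have "\<dots> = (\<integral>s. (\<integral>\<omega>. indicator {0..t} s * f s \<omega> \<partial>M) \<partial>lborel)"
    by (rule P.Fubini_integral[OF int])
  also have "\<dots> = (LINT s:{0..t}|lborel. expectation (f s))"
    by (simp add: set_lebesgue_integral_def)
  finally have eq: "expectation F = (LINT s:{0..t}|lborel. expectation (f s))" .
  have "integrable lborel (\<lambda>s. \<integral>\<omega>. indicator {0..t} s * f s \<omega> \<partial>M)"
    using P.integrable_fst[OF int] by simp
  then have "set_integrable lborel {0..t} (\<lambda>s. expectation (f s))"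
    by (simp add: set_integrable_def)
  from set_borel_integral_eq_integral[OF this] show ?thesis
    unfolding eq by (simp add: integrable_integral)
qed

text \<open>The probability generating function \<open>exp (r * (z - 1))\<close> at
  \<open>z = -1\<close>.\<close>

lemma expectation_poisson_sgn:
  assumes "0 < r"
  shows "(\<integral>k. (- 1) ^ k \<partial>measure_pmf (poisson_pmf r)) = exp (- (2 * r))"
proof -
  have s: "(\<lambda>k. pmf (poisson_pmf r) k * (- 1) ^ k) sums (exp (- r) * exp (- r))"
  proof -
    have "(\<lambda>k. exp (- r) * ((- r) ^ k /\<^sub>R fact k)) sums (exp (- r) * exp (- r))"
      by (intro sums_mult exp_converges)
    moreover have "exp (- r) * ((- r) ^ k /\<^sub>R fact k) = pmf (poisson_pmf r) k * (- 1) ^ k" for k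
      using assms by (simp add: power_minus[of r] divide_inverse)
    ultimately show ?thesis by simp
  qed
  have int: "integrable (count_space UNIV) (\<lambda>k. pmf (poisson_pmf r) k * (- 1) ^ k)"
    by (rule Bochner_Integration.integrable_bound[OF integrable_pmf[of UNIV "poisson_pmf r"]])
      (auto simp: power_abs abs_mult)
  have "(\<integral>k. (- 1) ^ k \<partial>measure_pmf (poisson_pmf r))
      = (\<integral>k. pmf (poisson_pmf r) k * (- 1) ^ k \<partial>count_space UNIV)"
    unfolding measure_pmf_eq_density by (subst integral_density) auto
  also have "\<dots> = exp (- r) * exp (- r)"
    using sums_integral_count_space_nat[OF int] s by (rule sums_unique2)
  finally show ?thesis
    by (simp flip: exp_add)
qed

section \<open>Joint measurability and independence of the past from the next increment\<close>

context poisson_process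
begin

abbreviation path :: "real \<Rightarrow> 'a \<Rightarrow> real" where
  "path t \<omega> \<equiv> sgn_path (\<lambda>s. N s \<omega>) t"

lemma counting_path: "\<omega> \<in> space M \<Longrightarrow> counting_path (\<lambda>s. N s \<omega>)"
  by unfold_locales (auto intro: N_mono N_right_continuous)

lemma N_le:
  assumes "\<omega> \<in> space M" "0 \<le> s" "s \<le> t"
  shows "N s \<omega> \<le> N t \<omega>"
  using N_mono[OF assms(1)] assms by (auto simp: mono_on_def)

lemma sgn_measurable:
  assumes "0 \<le> t"
  shows "(\<lambda>\<omega>. (- 1) ^ N t \<omega> :: real) \<in> borel_measurable M"
  by (rule measurable_compose[OF N_measurable[OF assms]]) simp

text \<open>Rounding the time up to a grid leaves countably many random variables to glue together,
  and right-continuity recovers the process in the limit. The \<open>max 0\<close> avoids negative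
  times, where \<open>N\<close> is unconstrained.\<close>

lemma sgn_joint_measurable:
  "(\<lambda>(s, \<omega>). (- 1) ^ N (max 0 s) \<omega> :: real) \<in> borel_measurable (borel \<Otimes>\<^sub>M M)"
proof (rule borel_measurable_LIMSEQ_real)
  let ?g = "\<lambda>i s. real_of_int \<lceil>real (Suc i) * s\<rceil> / real (Suc i)"
  let ?u = "\<lambda>i (s, \<omega>). (- 1) ^ N (max 0 (?g i s)) \<omega> :: real"
  show "(\<lambda>i. ?u i x) \<longlonglongrightarrow> (case x of (s, \<omega>) \<Rightarrow> (- 1) ^ N (max 0 s) \<omega>)"
    if x_in: "x \<in> space (borel \<Otimes>\<^sub>M M)" for x
  proof -
    obtain s \<omega> where x: "x = (s, \<omega>)" "\<omega> \<in> space M"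
      using x_in by (cases x) (auto simp: space_pair_measure)
    have "(\<lambda>i. max 0 (?g i s)) \<longlonglongrightarrow> max 0 s"
      by (intro tendsto_max tendsto_const grid_tendsto)
    moreover have "max 0 s \<le> max 0 (?g i s)" for i
    proof -
      have "s \<le> ?g i s" by (simp add: field_simps del: of_nat_Suc)
      then show ?thesis by auto
    qed
    ultimately have "eventually (\<lambda>i. N (max 0 (?g i s)) \<omega> = N (max 0 s) \<omega>) sequentially"
      using N_right_continuous[OF x(2)] by (intro right_continuous_tendsto) auto
    then show ?thesis
      unfolding x prod.case by (intro tendsto_eventually, elim eventually_mono) simp
  qed
  show "?u i \<in> borel_measurable (borel \<Otimes>\<^sub>M M)" for i
  proof -
    have "(\<lambda>x. (\<lambda>(j :: int) x. (- 1) ^ N (max 0 (real_of_int j / real (Suc i))) (snd x) :: real)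
        \<lceil>real (Suc i) * fst x\<rceil> x) \<in> borel_measurable (borel \<Otimes>\<^sub>M M)"
      by (rule measurable_compose_countable)
        (auto intro!: measurable_compose[OF measurable_snd sgn_measurable])
    then show ?thesis by (simp add: case_prod_beta')
  qed
qed

lemma path_eq_lebesgue: "path t \<omega> = (\<integral>s. indicator {0..t} s * (- 1) ^ N (max 0 s) \<omega> \<partial>lborel)"
  unfolding sgn_path_def set_lebesgue_integral_def
  by (intro Bochner_Integration.integral_cong) (auto simp: indicator_def)

lemma path_joint_measurable: "(\<lambda>(t, \<omega>). path t \<omega>) \<in> borel_measurable (borel \<Otimes>\<^sub>M M)"
proof -
  have [measurable]: "(\<lambda>x. (- 1) ^ N (max 0 (snd x)) (snd (fst x)) :: real)
      \<in> borel_measurable ((borel \<Otimes>\<^sub>M M) \<Otimes>\<^sub>M lborel)"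
    using measurable_compose[of "\<lambda>x. (snd x, snd (fst x))" "(borel \<Otimes>\<^sub>M M) \<Otimes>\<^sub>M lborel", OF _ sgn_joint_measurable] by simp
  have "(\<lambda>x. \<integral>s. indicator {0..fst x} s * (- 1) ^ N (max 0 s) (snd x) \<partial>lborel :: real)
      \<in> borel_measurable (borel \<Otimes>\<^sub>M M)"
    by (rule lborel.borel_measurable_lebesgue_integral[where f = "\<lambda>x s. indicator {0..fst x} s * (- 1) ^ N (max 0 s) (snd x)"]) (simp add: case_prod_beta' indicator_def, measurable)
  then show ?thesis by (simp add: path_eq_lebesgue case_prod_beta')
qed

lemma path_measurable: "path t \<in> borel_measurable M"
  using measurable_compose[OF measurable_Pair1' path_joint_measurable, of t] by simp

lemma abs_path_power_le:
  assumes "\<omega> \<in> space M" "0 \<le> s" "s \<le> t"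
  shows "\<bar>path s \<omega> ^ k\<bar> \<le> t ^ k"
  unfolding power_abs
  using counting_path.abs_sgn_path_le[OF counting_path[OF assms(1)] assms(2)] assms
  by (intro power_mono) auto

lemma expectation_sgn_increment:
  assumes "0 \<le> s" "s < t"
  shows "expectation (\<lambda>\<omega>. (- 1) ^ (N t \<omega> - N s \<omega>) :: real) = exp (- (2 * rate * (t - s)))"
proof -
  have [measurable]: "N s \<in> measurable M (count_space UNIV)" "N t \<in> measurable M (count_space UNIV)"
    using assms by (auto intro: N_measurable)
  have "expectation (\<lambda>\<omega>. (- 1) ^ (N t \<omega> - N s \<omega>) :: real)
      = (\<integral>k. (- 1) ^ k \<partial>distr M (count_space UNIV) (\<lambda>\<omega>. N t \<omega> - N s \<omega>))"
    by (rule integral_distr[of "\<lambda>\<omega>. N t \<omega> - N s \<omega>" M "count_space UNIV" "\<lambda>k. (- 1) ^ k", symmetric]) auto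
  also have "\<dots> = exp (- (2 * rate * (t - s)))"
    unfolding N_increments[OF assms] using assms rate_pos
    by (subst expectation_poisson_sgn) auto
  finally show ?thesis .
qed

text \<open>The Riemann sum is a function of the grid increments up to time \<open>s\<close>, which
  are jointly independent of the increment from \<open>s\<close> to \<open>t\<close>; the
  expectation therefore factors.\<close>

lemma expectation_riemann_sgn_increment:
  assumes s: "0 < s" "s < t"
  shows "expectation (\<lambda>\<omega>. counting_path.riemann_sgn (\<lambda>s. N s \<omega>) m s ^ k * (- 1) ^ (N t \<omega> - N s \<omega>))
    = expectation (\<lambda>\<omega>. counting_path.riemann_sgn (\<lambda>s. N s \<omega>) m s ^ k) * exp (- (2 * rate * (t - s)))"
proof -
  \<comment> \<open>The grid of \<open>[0, s]\<close> with \<open>t\<close> appended: increments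
    \<open>0..m\<close> lie before \<open>s\<close>, and increment number \<open>m + 1\<close> runs
    from \<open>s\<close> to \<open>t\<close>.\<close>
  define \<tau> where "\<tau> i = (if i \<le> Suc m then s * real i / real (Suc m) else t)" for i
  define X where "X i \<omega> = N (\<tau> (Suc i)) \<omega> - N (\<tau> i) \<omega>" for i \<omega>
  let ?A = "{..<Suc m}" and ?B = "{Suc m}"
  define f where "f x = (\<Sum>i<Suc m. s / real (Suc m) * (- 1) ^ (\<Sum>j\<le>i. x j)) ^ k" for x :: "nat \<Rightarrow> nat"
  define g where "g x = ((- 1) ^ x (Suc m) :: real)" for x :: "nat \<Rightarrow> nat"
  have \<tau>_less: "\<tau> i < \<tau> (Suc i)" if "i < Suc (Suc m)" for i
  proof (cases "i = Suc m")
    case False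
    then show ?thesis
      using that s unfolding \<tau>_def by (auto intro!: divide_strict_right_mono mult_strict_left_mono)
  qed (use s in \<open>simp add: \<tau>_def del: of_nat_Suc\<close>)
  have \<tau>_pos: "0 \<le> \<tau> i" for i
    using s by (auto simp: \<tau>_def)
  have \<tau>_eq: "\<tau> 0 = 0" "\<tau> (Suc m) = s" "\<tau> (Suc (Suc m)) = t"
    by (auto simp: \<tau>_def)
  have "indep_vars (\<lambda>_. count_space UNIV) X {..<Suc (Suc m)}"
    unfolding X_def[abs_def] using \<tau>_less by (intro N_indep_increments) (auto simp: \<tau>_eq)
  then have "indep_var (PiM ?A (\<lambda>_. count_space UNIV)) (\<lambda>\<omega>. restrict (\<lambda>i. X i \<omega>) ?A)
      (PiM ?B (\<lambda>_. count_space UNIV)) (\<lambda>\<omega>. restrict (\<lambda>i. X i \<omega>) ?B)"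
    by (rule indep_var_restrict) auto
  moreover have "f \<in> borel_measurable (PiM ?A (\<lambda>_. count_space UNIV))"
    unfolding f_def[abs_def] power_sum
    by (intro borel_measurable_power borel_measurable_sum borel_measurable_times borel_measurable_prod
        borel_measurable_const measurable_compose[OF measurable_component_singleton]) auto
  moreover have "g \<in> borel_measurable (PiM ?B (\<lambda>_. count_space UNIV))"
    unfolding g_def[abs_def]
    by (intro measurable_compose[OF measurable_component_singleton]) auto
  ultimately have ind: "indep_var borel (f \<circ> (\<lambda>\<omega>. restrict (\<lambda>i. X i \<omega>) ?A)) borel (g \<circ> (\<lambda>\<omega>. restrict (\<lambda>i. X i \<omega>) ?B))"
    by (rule indep_var_compose)
  have f: "(f \<circ> (\<lambda>\<omega>. restrict (\<lambda>i. X i \<omega>) ?A)) \<omega> = counting_path.riemann_sgn (\<lambda>s. N s \<omega>) m s ^ k"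
    if \<omega>: "\<omega> \<in> space M" for \<omega>
  proof -
    \<comment> \<open>The increments telescope from \<open>N 0 = 0\<close>; monotone paths make the
      truncated subtraction exact.\<close>
    have sum: "(\<Sum>j\<le>i. X j \<omega>) = N (\<tau> (Suc i)) \<omega>" if "i < Suc m" for i
      using that
    proof (induction i)
      case 0
      then show ?case using N_zero[OF \<omega>] by (simp add: X_def \<tau>_eq)
    next
      case (Suc i)
      then show ?case
        using N_le[OF \<omega> \<tau>_pos less_imp_le[OF \<tau>_less], of "Suc i"] by (simp add: X_def)
    qed
    have "(\<Sum>j\<le>i. restrict (\<lambda>i. X i \<omega>) ?A j) = N (s * real (Suc i) / real (Suc m)) \<omega>" if "i < Suc m" for i
    proof -
      have "(\<Sum>j\<le>i. restrict (\<lambda>i. X i \<omega>) ?A j) = (\<Sum>j\<le>i. X j \<omega>)"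
        using that by (intro sum.cong) auto
      then show ?thesis using sum[OF that] that by (simp add: \<tau>_def)
    qed
    then show ?thesis
      by (simp add: f_def counting_path.riemann_sgn_def[OF counting_path[OF \<omega>]] del: sum.lessThan_Suc)
  qed
  have g: "(g \<circ> (\<lambda>\<omega>. restrict (\<lambda>i. X i \<omega>) ?B)) \<omega> = (- 1) ^ (N t \<omega> - N s \<omega>)" for \<omega>
    by (simp add: g_def X_def \<tau>_eq)
  have rv: "random_variable borel (f \<circ> (\<lambda>\<omega>. restrict (\<lambda>i. X i \<omega>) ?A))"
    "random_variable borel (g \<circ> (\<lambda>\<omega>. restrict (\<lambda>i. X i \<omega>) ?B))"
    using ind by (auto simp: indep_var_eq)
  have "integrable M (f \<circ> (\<lambda>\<omega>. restrict (\<lambda>i. X i \<omega>) ?A))"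
    using rv s counting_path.abs_riemann_sgn_le[OF counting_path, of _ s m]
    by (intro integrable_const_bound[where B = "s ^ k"])
      (auto simp: f power_abs simp del: o_apply intro!: AE_I2 power_mono)
  moreover have "integrable M (g \<circ> (\<lambda>\<omega>. restrict (\<lambda>i. X i \<omega>) ?B))"
    using rv by (intro integrable_const_bound[where B = 1]) (auto simp: g power_abs simp del: o_apply)
  ultimately have "expectation (\<lambda>\<omega>. (f \<circ> (\<lambda>\<omega>. restrict (\<lambda>i. X i \<omega>) ?A)) \<omega> * (g \<circ> (\<lambda>\<omega>. restrict (\<lambda>i. X i \<omega>) ?B)) \<omega>)
    = expectation (f \<circ> (\<lambda>\<omega>. restrict (\<lambda>i. X i \<omega>) ?A)) * expectation (g \<circ> (\<lambda>\<omega>. restrict (\<lambda>i. X i \<omega>) ?B))"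
    by (intro indep_var_lebesgue_integral ind)
  moreover have "expectation (g \<circ> (\<lambda>\<omega>. restrict (\<lambda>i. X i \<omega>) ?B)) = exp (- (2 * rate * (t - s)))"
    using expectation_sgn_increment[of s t] s unfolding g by (simp add: comp_def g[unfolded comp_def])
  ultimately show ?thesis
    unfolding g by (simp add: f[unfolded comp_def] cong: Bochner_Integration.integral_cong)
qed

end

context poisson_process
begin

lemma integrable_path_power:
  assumes "0 \<le> s"
  shows "integrable M (\<lambda>\<omega>. path s \<omega> ^ k)"
  using abs_path_power_le[OF _ assms order_refl] path_measurable[of s]
  by (auto intro!: integrable_const_bound[where B = "s ^ k"])

text \<open>Limit of the factorization for Riemann sums, dominated by the constant
  \<open>s ^ k\<close>.\<close>

lemma expectation_path_increment:
  assumes s: "0 < s" "s < t"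
  shows "expectation (\<lambda>\<omega>. path s \<omega> ^ k * (- 1) ^ N s \<omega> * (- 1) ^ N t \<omega>)
    = exp (- (2 * rate * (t - s))) * expectation (\<lambda>\<omega>. path s \<omega> ^ k)"
proof -
  let ?R = "\<lambda>m \<omega>. counting_path.riemann_sgn (\<lambda>s. N s \<omega>) m s"
  note [measurable] = path_measurable
  have [measurable]: "(\<lambda>\<omega>. (- 1) ^ N s \<omega> :: real) \<in> borel_measurable M"
    "(\<lambda>\<omega>. (- 1) ^ N t \<omega> :: real) \<in> borel_measurable M"
    using s by (auto intro: sgn_measurable)
  have Rm[measurable]: "?R m \<in> borel_measurable M" for m
  proof -
    have "(\<lambda>\<omega>. \<Sum>i<Suc m. s / real (Suc m) * (- 1) ^ N (s * real (Suc i) / real (Suc m)) \<omega>) \<in> borel_measurable M"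
      using s by (intro borel_measurable_sum borel_measurable_times borel_measurable_const sgn_measurable) auto
    then show ?thesis
      by (rule measurable_cong[THEN iffD1, rotated])
        (simp add: counting_path.riemann_sgn_def[OF counting_path] del: sum.lessThan_Suc)
  qed
  have lim: "(\<lambda>m. ?R m \<omega> ^ k) \<longlonglongrightarrow> path s \<omega> ^ k" if "\<omega> \<in> space M" for \<omega>
    using counting_path.riemann_sgn_tendsto[OF counting_path[OF that] s(1)] by (rule tendsto_power)
  have bd: "\<bar>?R m \<omega>\<bar> ^ k \<le> s ^ k" if "\<omega> \<in> space M" for \<omega> m
    using counting_path.abs_riemann_sgn_le[OF counting_path[OF that], of s m] s
    by (intro power_mono) auto
  \<comment> \<open>The sum and the difference of \<open>N t\<close> and \<open>N s\<close> have the
    same parity.\<close>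
  have sgn_inc: "(- 1) ^ N s \<omega> * (- 1) ^ N t \<omega> = ((- 1) ^ (N t \<omega> - N s \<omega>) :: real)" if "\<omega> \<in> space M" for \<omega>
    using N_le[OF that, of s t] s by (simp flip: power_add) (simp add: minus_one_power_iff)
  have "(\<lambda>m. expectation (\<lambda>\<omega>. ?R m \<omega> ^ k * (- 1) ^ (N t \<omega> - N s \<omega>)))
      \<longlonglongrightarrow> expectation (\<lambda>\<omega>. path s \<omega> ^ k * ((- 1) ^ N s \<omega> * (- 1) ^ N t \<omega>))"
  proof (rule integral_dominated_convergence[where w = "\<lambda>_. s ^ k"])
    show "(\<lambda>\<omega>. ?R m \<omega> ^ k * (- 1) ^ (N t \<omega> - N s \<omega>)) \<in> borel_measurable M" for m
    proof -
      have "(\<lambda>\<omega>. ?R m \<omega> ^ k * ((- 1) ^ N s \<omega> * (- 1) ^ N t \<omega>)) \<in> borel_measurable M"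
        by measurable
      then show ?thesis
        by (rule measurable_cong[THEN iffD1, rotated]) (simp add: sgn_inc)
    qed
    show "AE \<omega> in M. (\<lambda>m. ?R m \<omega> ^ k * (- 1) ^ (N t \<omega> - N s \<omega>))
        \<longlonglongrightarrow> path s \<omega> ^ k * ((- 1) ^ N s \<omega> * (- 1) ^ N t \<omega>)"
      by (intro AE_I2) (simp only: sgn_inc, intro tendsto_intros lim)
    show "AE \<omega> in M. norm (?R m \<omega> ^ k * (- 1) ^ (N t \<omega> - N s \<omega>)) \<le> s ^ k" for m
      by (intro AE_I2) (simp add: abs_mult power_abs bd)
  qed measurable
  moreover have "(\<lambda>m. expectation (\<lambda>\<omega>. ?R m \<omega> ^ k) * exp (- (2 * rate * (t - s))))
      \<longlonglongrightarrow> expectation (\<lambda>\<omega>. path s \<omega> ^ k) * exp (- (2 * rate * (t - s)))"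
  proof (intro tendsto_mult tendsto_const integral_dominated_convergence[where w = "\<lambda>_. s ^ k"])
    show "AE \<omega> in M. (\<lambda>m. ?R m \<omega> ^ k) \<longlonglongrightarrow> path s \<omega> ^ k"
      by (intro AE_I2 lim)
    show "AE \<omega> in M. norm (?R m \<omega> ^ k) \<le> s ^ k" for m
      by (intro AE_I2) (simp add: power_abs bd)
  qed measurable
  ultimately show ?thesis
    unfolding expectation_riemann_sgn_increment[OF s]
    by (simp add: LIMSEQ_unique mult_ac)
qed

subsection \<open>Moment recursion\<close>

text \<open>These are moments of Y; the velocity enters only at the end as an independent
  factor.\<close>

definition moment :: "nat \<Rightarrow> real \<Rightarrow> real" where
  "moment k t = expectation (\<lambda>\<omega>. path t \<omega> ^ k)"

definition sgn_moment :: "nat \<Rightarrow> real \<Rightarrow> real" where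
  "sgn_moment k t = expectation (\<lambda>\<omega>. path t \<omega> ^ k * (- 1) ^ N t \<omega>)"

lemma path_sgn_joint_measurable:
  "(\<lambda>(s, \<omega>). path s \<omega> ^ k * (- 1) ^ N (max 0 s) \<omega> :: real) \<in> borel_measurable (borel \<Otimes>\<^sub>M M)"
  using borel_measurable_times[OF borel_measurable_power[OF path_joint_measurable, of k] sgn_joint_measurable]
  by (simp add: case_prod_beta')

lemma path_power_has_integral:
  assumes "0 \<le> t" "\<omega> \<in> space M"
  shows "((\<lambda>s. real (Suc k) * (path s \<omega> ^ k * (- 1) ^ N (max 0 s) \<omega>)) has_integral path t \<omega> ^ Suc k) {0..t}"
  using counting_path.sgn_path_power_has_integral[OF counting_path[OF assms(2)] assms(1), of k]
  by (rule has_integral_eq[rotated]) auto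

lemma moment_has_integral:
  assumes "0 \<le> t"
  shows "((\<lambda>s. real (Suc k) * sgn_moment k s) has_integral moment (Suc k) t) {0..t}"
proof -
  have "((\<lambda>s. expectation (\<lambda>\<omega>. real (Suc k) * (path s \<omega> ^ k * (- 1) ^ N (max 0 s) \<omega>)))
      has_integral expectation (\<lambda>\<omega>. path t \<omega> ^ Suc k)) {0..t}"
  proof (rule has_integral_expectation)
    show "(\<lambda>(s, \<omega>). real (Suc k) * (path s \<omega> ^ k * (- 1) ^ N (max 0 s) \<omega>)) \<in> borel_measurable (borel \<Otimes>\<^sub>M M)"
      using borel_measurable_times[OF borel_measurable_const path_sgn_joint_measurable[of k]]
      by (simp add: case_prod_beta')
    show "\<bar>real (Suc k) * (path s \<omega> ^ k * (- 1) ^ N (max 0 s) \<omega>)\<bar> \<le> real (Suc k) * t ^ k"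
      if "s \<in> {0..t}" "\<omega> \<in> space M" for s \<omega>
      using abs_path_power_le[OF that(2), of s t k] that by (simp add: abs_mult power_abs del: of_nat_Suc)
  qed (use assms path_power_has_integral in auto)
  then show ?thesis
    unfolding moment_def
    by (rule has_integral_eq[rotated]) (auto simp: sgn_moment_def max_def)
qed

text \<open>The pathwise identity is multiplied by the terminal sign at \<open>t\<close> before
  averaging; then the sign at \<open>s\<close> pairs with it to form the sign of an independent
  increment.\<close>

lemma sgn_moment_has_integral:
  assumes t: "0 \<le> t"
  shows "((\<lambda>s. real (Suc k) * (exp (- (2 * rate * (t - s))) * moment k s))
    has_integral sgn_moment (Suc k) t) {0..t}"
proof -
  have "((\<lambda>s. expectation (\<lambda>\<omega>. real (Suc k) * (path s \<omega> ^ k * (- 1) ^ N (max 0 s) \<omega>) * (- 1) ^ N t \<omega>))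
      has_integral expectation (\<lambda>\<omega>. path t \<omega> ^ Suc k * (- 1) ^ N t \<omega>)) {0..t}"
  proof (rule has_integral_expectation)
    show "(\<lambda>(s, \<omega>). real (Suc k) * (path s \<omega> ^ k * (- 1) ^ N (max 0 s) \<omega>) * (- 1) ^ N t \<omega>)
        \<in> borel_measurable (borel \<Otimes>\<^sub>M M)"
      using borel_measurable_times[OF borel_measurable_times[OF borel_measurable_const path_sgn_joint_measurable[of k]]
        measurable_compose[OF measurable_snd sgn_measurable[OF t]]]
      by (simp add: case_prod_beta')
    show "\<bar>real (Suc k) * (path s \<omega> ^ k * (- 1) ^ N (max 0 s) \<omega>) * (- 1) ^ N t \<omega>\<bar> \<le> real (Suc k) * t ^ k"
      if "s \<in> {0..t}" "\<omega> \<in> space M" for s \<omega>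
      using abs_path_power_le[OF that(2), of s t k] that by (simp add: abs_mult power_abs del: of_nat_Suc)
  qed (intro has_integral_mult_left path_power_has_integral t)
  then show ?thesis
    unfolding sgn_moment_def
  \<comment> \<open>The factorization is available only for \<open>0 < s < t\<close>, so both
    endpoints are discarded as a finite set.\<close>
  proof (rule has_integral_spike_finite[of "{0, t}", rotated 2])
    fix s assume s: "s \<in> {0..t} - {0, t}"
    then show "real (Suc k) * (exp (- (2 * rate * (t - s))) * moment k s)
        = expectation (\<lambda>\<omega>. real (Suc k) * (path s \<omega> ^ k * (- 1) ^ N (max 0 s) \<omega>) * (- 1) ^ N t \<omega>)"
      using expectation_path_increment[of s t k] by (simp add: moment_def mult.assoc del: of_nat_Suc)
  qed simp
qed

lemma sgn_moment_odd:
  assumes "\<And>s. 0 \<le> s \<Longrightarrow> moment (2 * m) s = even_moment rate m s" and t: "0 \<le> t"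
  shows "sgn_moment (Suc (2 * m)) t = odd_moment rate m t"
proof -
  have "((\<lambda>s. real (Suc (2 * m)) * (exp (- (2 * rate * (t - s))) * moment (2 * m) s))
      has_integral real (Suc (2 * m)) * (odd_moment rate m t / real (2 * m + 1))) {0..t}"
    using has_integral_mult_right[OF odd_moment_eq_integral[OF t, of rate m], of "real (Suc (2 * m))"]
    by (rule has_integral_eq[rotated]) (use assms in auto)
  from has_integral_unique[OF sgn_moment_has_integral[OF t] this] show ?thesis
    by simp
qed

text \<open>Each induction step passes through both integral equations, from \<open>u_(2m)\<close>
  over \<open>w_(2m+1)\<close> to \<open>u_(2m+2)\<close>; uniqueness of the integral identifies the
  two sides.\<close>

lemma moment_even:
  assumes "0 \<le> t"
  shows "moment (2 * m) t = even_moment rate m t"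
  using assms
proof (induction m arbitrary: t)
  case 0
  show ?case by (simp add: moment_def even_moment_0 prob_space)
next
  case (Suc m)
  have "((\<lambda>s. real (Suc (Suc (2 * m))) * sgn_moment (Suc (2 * m)) s)
      has_integral real (Suc (Suc (2 * m))) * (even_moment rate (Suc m) t / real (2 * m + 2))) {0..t}"
    using has_integral_mult_right[OF even_moment_eq_integral[OF Suc.prems, of rate m], of "real (Suc (Suc (2 * m)))"]
    by (rule has_integral_eq[rotated]) (simp add: sgn_moment_odd[OF Suc.IH])
  from has_integral_unique[OF moment_has_integral[OF Suc.prems] this] show ?case
    by (simp del: of_nat_Suc)
qed

end

section \<open>Independence of the random velocity and moments of the telegraph process\<close>

context telegraph_process
begin

text \<open>Independence of V is assumed relative to the sigma-algebra of the whole process, so Y(t)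
  must be measurable there. Riemann sums depend on finitely many coordinates, and limits preserve
  measurability.\<close>

lemma path_measurable_history:
  assumes "0 < t"
  shows "path t \<in> borel_measurable (vimage_algebra (space M) (\<lambda>\<omega>. restrict (\<lambda>t. N t \<omega>) {0..})
    (PiM {0..} (\<lambda>_. count_space UNIV)))" (is "_ \<in> borel_measurable ?H")
proof (rule borel_measurable_LIMSEQ_real)
  let ?f = "\<lambda>\<omega>. restrict (\<lambda>t. N t \<omega>) {0..}"
  show "(\<lambda>m. counting_path.riemann_sgn (\<lambda>s. N s \<omega>) m t) \<longlonglongrightarrow> path t \<omega>" if "\<omega> \<in> space ?H" for \<omega>
    using counting_path.riemann_sgn_tendsto[OF counting_path assms] that by simp
  have f: "?f \<in> ?H \<rightarrow>\<^sub>M PiM {0..} (\<lambda>_. count_space UNIV)"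
    by (rule measurable_vimage_algebra1) (auto simp: space_PiM)
  have N: "N s \<in> ?H \<rightarrow>\<^sub>M count_space UNIV" if "0 \<le> s" for s
    using measurable_compose[OF f measurable_component_singleton, of s] that by simp
  show "(\<lambda>\<omega>. counting_path.riemann_sgn (\<lambda>s. N s \<omega>) m t) \<in> borel_measurable ?H" for m
  proof -
    have "(\<lambda>\<omega>. \<Sum>i<Suc m. t / real (Suc m) * (- 1) ^ N (t * real (Suc i) / real (Suc m)) \<omega>) \<in> borel_measurable ?H"
      using assms by (intro borel_measurable_sum borel_measurable_times borel_measurable_const
          measurable_compose[OF N]) auto
    then show ?thesis
      by (rule measurable_cong[THEN iffD1, rotated])
        (simp add: counting_path.riemann_sgn_def[OF counting_path] del: sum.lessThan_Suc)
  qed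
qed

lemma indep_velocity_path:
  assumes "0 < t"
  shows "indep_var borel V borel (path t)"
  unfolding indep_var_eq
proof (intro conjI)
  let ?H = "vimage_algebra (space M) (\<lambda>\<omega>. restrict (\<lambda>t. N t \<omega>) {0..}) (PiM {0..} (\<lambda>_. count_space UNIV))"
  have "{path t -` A \<inter> space M |A. A \<in> sets borel} \<subseteq> sets ?H"
    using measurable_sets[OF path_measurable_history[OF assms]] by auto
  then have "sigma_sets (space M) {path t -` A \<inter> space M |A. A \<in> sets borel} \<subseteq> sets ?H"
    using sets.sigma_sets_subset[of _ ?H] by simp
  moreover have "sigma_sets (space M) {V -` A \<inter> space M |A. A \<in> sets borel} = sets (vimage_algebra (space M) V borel)"
    by (simp add: sets_vimage_algebra)
  ultimately show "indep_set (sigma_sets (space M) {V -` A \<inter> space M |A. A \<in> sets borel})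
      (sigma_sets (space M) {path t -` A \<inter> space M |A. A \<in> sets borel})"
    using V_indep_N unfolding indep_set_def
    by (elim indep_sets_mono_sets) (auto split: bool.split)
qed (use V_measurable path_measurable in auto)

lemma AE_velocity: "AE \<omega> in M. V \<omega> = v \<or> V \<omega> = - v"
proof -
  note [measurable] = V_measurable
  \<comment> \<open>The events are disjoint because \<open>v\<close> is positive, so the two halves
    add up to 1.\<close>
  have "prob ({\<omega> \<in> space M. V \<omega> = v} \<union> {\<omega> \<in> space M. V \<omega> = - v}) = 1"
    using v_pos V_plus V_minus by (subst finite_measure_Union) auto
  then show ?thesis
    by (subst (asm) prob_eq_1) (auto elim: eventually_mono)
qed

text \<open>The source of the factor \<open>1 + (-1) ^ p\<close>, and of the 1/2 beside the
  exponential in the final formula.\<close>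

lemma velocity_moment:
  "integrable M (\<lambda>\<omega>. V \<omega> ^ p)" "expectation (\<lambda>\<omega>. V \<omega> ^ p) = (1 + (- 1) ^ p) * v ^ p / 2"
proof -
  note [measurable] = V_measurable
  show "integrable M (\<lambda>\<omega>. V \<omega> ^ p)"
    by (rule integrable_const_bound[where B = "v ^ p"])
      (use AE_velocity v_pos in \<open>auto simp: power_abs elim!: eventually_mono\<close>)
  have ind: "integrable M (indicator {\<omega> \<in> space M. V \<omega> = c} :: 'a \<Rightarrow> real)" for c
    by (intro integrable_real_indicator) (auto simp: less_top[symmetric])
  have "expectation (\<lambda>\<omega>. V \<omega> ^ p)
      = expectation (\<lambda>\<omega>. v ^ p * indicator {\<omega> \<in> space M. V \<omega> = v} \<omega> + (- v) ^ p * indicator {\<omega> \<in> space M. V \<omega> = - v} \<omega>)"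
    by (rule integral_cong_AE)
      (use AE_velocity v_pos AE_space in \<open>auto simp: indicator_def elim!: eventually_elim2\<close>)
  also have "\<dots> = v ^ p * (1 / 2) + (- v) ^ p * (1 / 2)"
    by (subst Bochner_Integration.integral_add) (auto simp: ind V_plus V_minus)
  also have "\<dots> = (1 + (- 1) ^ p) * v ^ p / 2"
    by (simp add: power_minus[of v] algebra_simps)
  finally show "expectation (\<lambda>\<omega>. V \<omega> ^ p) = (1 + (- 1) ^ p) * v ^ p / 2" .
qed

lemma telegraph_moment:
  assumes "0 < t"
  shows "integrable M (\<lambda>\<omega>. telegraph V N t \<omega> ^ p)"
    and "expectation (\<lambda>\<omega>. telegraph V N t \<omega> ^ p) = (1 + (- 1) ^ p) * v ^ p / 2 * moment p t"
proof -
  have "indep_var borel ((\<lambda>x. x ^ p) \<circ> V) borel ((\<lambda>x. x ^ p) \<circ> path t)"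
    by (rule indep_var_compose[OF indep_velocity_path[OF assms]]) auto
  then have ind: "indep_var borel (\<lambda>\<omega>. V \<omega> ^ p) borel (\<lambda>\<omega>. path t \<omega> ^ p)"
    by (simp add: comp_def)
  have eq: "telegraph V N t \<omega> ^ p = V \<omega> ^ p * path t \<omega> ^ p" for \<omega>
    by (simp add: telegraph_def sgn_path_def power_mult_distrib)
  have int: "integrable M (\<lambda>\<omega>. path t \<omega> ^ p)"
    using assms by (intro integrable_path_power) auto
  show "integrable M (\<lambda>\<omega>. telegraph V N t \<omega> ^ p)"
    unfolding eq by (rule indep_var_integrable[OF ind velocity_moment(1) int])
  show "expectation (\<lambda>\<omega>. telegraph V N t \<omega> ^ p) = (1 + (- 1) ^ p) * v ^ p / 2 * moment p t"
    unfolding eq indep_var_lebesgue_integral[OF ind velocity_moment(1) int] velocity_moment(2) moment_def ..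
qed

end

theorem theorem2p1:
  fixes M :: "'a measure" and v lam t :: real and p :: nat
    and V :: "'a \<Rightarrow> real" and N :: "real \<Rightarrow> 'a \<Rightarrow> nat"
  assumes "0 < v" and "0 < lam"
    and "telegraph_process M v lam V N"
    and "1 \<le> p" and "0 < t"
  shows "integrable M (\<lambda>\<omega>. telegraph V N t \<omega> ^ p) \<and>
    prob_space.expectation M (\<lambda>\<omega>. telegraph V N t \<omega> ^ p) =
      (1 + (- 1) ^ p) * (v * t) ^ p * (2 / (lam * t)) powr ((real p - 1) / 2)
      * Gamma ((real p + 1) / 2)
      * (bessel_I ((real p + 1) / 2) (lam * t) + bessel_I ((real p - 1) / 2) (lam * t))
      * (exp (- (lam * t)) / 2)"
proof -
  interpret telegraph_process M v lam V N by (rule assms(3))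
  show ?thesis
  proof (cases "even p")
    case True
    then obtain m where p: "p = 2 * m" by auto
    \<comment> \<open>For \<open>p = 2 * m\<close> the exponent and the Bessel orders become those
      of the closed form of \<open>u_(2m)\<close>.\<close>
    have expos: "(real p - 1) / 2 = real m - 1 / 2" "(real p + 1) / 2 = real m + 1 / 2"
      unfolding p by (simp_all add: field_simps)
    show ?thesis
      unfolding expos
      using telegraph_moment[OF assms(5), of p] moment_even[of t m] assms(5)
        even_moment_eq_bessel_I[OF assms(2,5), of m]
      by (simp add: p power_mult_distrib)
  \<comment> \<open>For odd \<open>p\<close> both sides vanish through the factor
    \<open>1 + (-1) ^ p\<close>.\<close>
  qed (use telegraph_moment[OF assms(5), of p] in simp)
qed

end
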